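(* Let $R$ be an elliptic root system with marking, $\widetilde c\in W$ a hyperbolic Coxeter transformation with semi-simple part $\widetilde c^{ss}$, and let $\zeta$ be the unique primitive $d_n$-th root of unity such that $\widetilde c^{ss}\cdot f=\zeta^m f$ for all $m\in\mathbb Z_{\ge0}$ and $f\in S^W_m$. Let $L$ be any real subspace of $\widetilde F$ with $\widetilde F=L\oplus\mathrm{rad}\,I$, $\widetilde c^{ss}(L)=L$ and $L\cap R=\emptyset$ (i.e. $L\in\widetilde X^{\widetilde c^{ss}}\cap\widetilde X^{reg}$). Then $(\widetilde c^{ss},\zeta,L)$ is an admissible triplet.
   Context: Root system. $l\ge 1$ is an integer, $n=l+1$. $F$ is a real vector space of dimension $l+2$ with a positive semi-definite symmetric bilinear form $I$ whose radical $\mathrm{rad}\,I$ has dimension $2$. For $\alpha\in F$ with $I(\alpha,\alpha)\ne0$ put $\alpha^\vee=2\alpha/I(\alpha,\alpha)$, $w_\alpha(u)=u-I(u,\alpha^\vee)\alpha$. $R\subset F$ is an elliptic root system belonging to $(F,I)$: a set of vectors with $I(\alpha,\alpha)\neq 0$ such that (1) the additive group $Q(R)$ generated by $R$ is a full lattice in $F$; (2) $I(\alpha,\beta^\vee)\in\mathbb Z$ for $\alpha,\beta\in R$; (3) $w_\alpha(R)=R$ for $\alpha\in R$; (4) if $R=R_1\cup R_2$ with $R_1\perp R_2$ then $R_1$ or $R_2$ is empty. A marking is fixed: a line $G\subset\mathrm{rad}\,I$ with $G\cap Q(R)\simeq\mathbb Z$; $a,\delta$ are chosen with $G\cap Q(R)=\mathbb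 Za$, $Q(R)\cap\mathrm{rad}\,I=\mathbb Za\oplus\mathbb Z\delta$. $(I_R:I)>0$ is the smallest number such that $(I_R:I)I$ makes $Q(R)$ an even lattice. Hyperbolic extension. $\widetilde F\supset F$ is a real vector space of dimension $l+3$ with symmetric bilinear form $\widetilde I$, $\widetilde I|_F=I$, $\mathrm{rad}\,\widetilde I=\mathbb Ra$; $\Lambda_0\in\widetilde F$ satisfies $\widetilde I(\Lambda_0,\delta)=1$, $\widetilde I(\Lambda_0,\Lambda_0)=0$. $O(F,\mathrm{rad}\,I)$ is the group of $g\in GL(F)$ preserving $I$ with $g|_{\mathrm{rad}\,I}=id$; $O(\widetilde F,F,\mathrm{rad}\,I)$ is the group of $g\in GL(\widetilde F)$ preserving $\widetilde I$ with $g(F)\subset F$ and $g|_F\in O(F,\mathrm{rad}\,I)$; $K_{\mathbb R}$ is the kernel of the restriction map $O(\widetilde F,F,\mathrm{rad}\,I)\to O(F,\mathrm{rad}\,I)$. The elliptic Weyl group $W\subset O(\widetilde F,F,\mathrm{rad}\,I)$ is generated by $\widetilde w_\alpha(u)=u-\widetilde I(u,\alpha^\vee)\alpha$ ($\alpha\in R$); $K_{\mathbb Z}:=W\cap K_{\mathbb R}\simeq\mathbb Z$. Exponents. Following Saito, the image of $R$ in $F/G$ is a reduced affine root system. Let $\alpha_0,\dots,\alpha_l\in R$ be lifts of its simple roots, $n_i$ the coprime positive integers with $\sum n_i\alpha_i\equiv\pm\delta$ mod $G$, $k(\alpha)=\min\{k\in\mathbb Z_{>0}\mid\alpha+ka\in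 R\}$. The exponents $m_0\le\dots\le m_l=:m_{max}$ are the numbers $(I_R:I)I(\alpha_i,\alpha_i)n_i/(2k(\alpha_i))$ in increasing order. $d_n$ is the smallest common denominator of the $m_i/m_{max}$, and $d_\alpha:=m_{\alpha-1}d_n/m_{max}$ ($1\le\alpha\le n$). Invariants. $Y=\{x\in\mathrm{Hom}_{\mathbb R}(\widetilde F,\mathbb C)\mid\langle a,x\rangle=-2\pi\sqrt{-1},\ \mathrm{Re}\langle\delta,x\rangle>0\}$, $H=\{x\in\mathrm{Hom}_{\mathbb R}(\mathrm{rad}\,I,\mathbb C)\mid \langle a,x\rangle=-2\pi\sqrt{-1},\ \mathrm{Re}\langle\delta,x\rangle>0\}$, $\pi:Y\to H$ restriction; $F(Y),F(H)$ are the rings of holomorphic functions, $F(H)\subset F(Y)$ via $\pi^*$. $g\in O(\widetilde F,F,\mathrm{rad}\,I)$ acts on $Y$ by $\langle\gamma,g\cdot x\rangle=\langle g^{-1}\gamma,x\rangle$ and on functions by $(g\cdot f)(x)=f(g^{-1}x)$. The Euler field $E$ is the vector field on $Y$ with $E(f)=0$ for $f\in F$ and $E(\Lambda_0)=(I_R:I)d_n/m_{max}$. $S^W_m$ is the set of $W$-invariant $f\in F(Y)$ with $Ef=mf$; $S^W=\bigoplus_{m\ge0}S^W_m$. It is known that $S^W$ is a polynomial $F(H)$-algebra on algebraically independent homogeneous generators $x^1,\dots,x^n$ of degrees $0<d_1\le\dots\le d_n$, called a set of basic invariants. Hyperbolic Coxeter transformation. By a theorem of Saito (taken as given) there is $\widetilde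 c\in W$, called a hyperbolic Coxeter transformation, such that, with $c:=\widetilde c|_F$: (A) $c$ is semi-simple of order $d_n$, with eigenvalues $1$ and $\exp(2\pi\sqrt{-1}\,d_\alpha/d_n)$ ($\alpha=1,\dots,n$); (B) $R\cap\mathrm{Im}(c-id)=\emptyset$; (C) $(\widetilde c-1)\xi+(I_R:I)\widetilde I(\xi,\delta)\frac1{m_{max}}a\in\mathrm{Im}(c-id)$ for all $\xi\in\widetilde F$, and $\widetilde c^{\,d_n}$ generates $K_{\mathbb Z}$. $\widetilde c=\widetilde c^{ss}\cdot\widetilde c^{unip}$ denotes the Jordan decomposition. Such a unique $\zeta$ as in the claim exists. Admissible triplet. $(g,\zeta,L)$ with $g\in O(\widetilde F,F,\mathrm{rad}\,I)$, $\zeta\in\mathbb C^*$, $L\subset\widetilde F$ a subspace, is admissible if: (i) $g$ is semi-simple and $(g-id)(\widetilde F)\subset F$; (ii) $\zeta$ is a primitive $d_n$-th root of unity and $g\cdot x^\alpha=\zeta^{d_\alpha}x^\alpha$ ($1\le\alpha\le n$) for a set of basic invariants $x^1,\dots,x^n$ with degrees $d_1,\dots,d_n$; (iii) $\widetilde F=L\oplus\mathrm{rad}\,I$, $g(L)=L$, $L\cap R=\emptyset$. *)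

theory Defs
  imports
    "HOL-Complex_Analysis.Complex_Analysis"
    "HOL-Computational_Algebra.Group_Closure"
begin

(* The ambient space tilde F is the whole type 'v; F is a subspace of it and I is the restriction
   to F of the form B = tilde I.  The inner product of the class euclidean_space is never used:
   it only provides finite dimension and the (canonical) topology. *)

definition is_minimum :: "'a::order set \<Rightarrow> 'a \<Rightarrow> bool" where
  "is_minimum S x \<longleftrightarrow> x \<in> S \<and> (\<forall>y\<in>S. x \<le> y)"


section \<open>Elliptic root systems and markings\<close>

definition form_radical :: "('v \<Rightarrow> 'v \<Rightarrow> real) \<Rightarrow> 'v set \<Rightarrow> 'v set" where
  "form_radical B S = {u\<in>S. \<forall>v\<in>S. B u v = 0}"

definition coroot :: "('v::real_vector \<Rightarrow> 'v \<Rightarrow> real) \<Rightarrow> 'v \<Rightarrow> 'v" where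
  "coroot B \<alpha> = (2 / B \<alpha> \<alpha>) *\<^sub>R \<alpha>"

definition root_reflection :: "('v::real_vector \<Rightarrow> 'v \<Rightarrow> real) \<Rightarrow> 'v \<Rightarrow> 'v \<Rightarrow> 'v" where
  "root_reflection B \<alpha> u = u - B u (coroot B \<alpha>) *\<^sub>R \<alpha>"

definition full_lattice :: "'v::real_vector set \<Rightarrow> 'v set \<Rightarrow> bool" where
  "full_lattice Q F \<longleftrightarrow> (\<exists>S. independent S \<and> span S = F \<and> Q = group_closure S)"

definition elliptic_root_system ::
  "nat \<Rightarrow> 'v::real_vector set \<Rightarrow> ('v \<Rightarrow> 'v \<Rightarrow> real) \<Rightarrow> 'v set \<Rightarrow> bool" where
  "elliptic_root_system l F B R \<longleftrightarrow>
     subspace F \<and> dim F = l + 2 \<and> (\<forall>u\<in>F. B u u \<ge> 0) \<and> dim (form_radical B F) = 2 \<and>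
     R \<subseteq> F \<and> (\<forall>\<alpha>\<in>R. B \<alpha> \<alpha> \<noteq> 0) \<and>
     full_lattice (group_closure R) F \<and>
     (\<forall>\<alpha>\<in>R. \<forall>\<beta>\<in>R. B \<alpha> (coroot B \<beta>) \<in> \<int>) \<and>
     (\<forall>\<alpha>\<in>R. root_reflection B \<alpha> ` R = R) \<and>
     (\<forall>R1 R2. R = R1 \<union> R2 \<and> (\<forall>\<alpha>\<in>R1. \<forall>\<beta>\<in>R2. B \<alpha> \<beta> = 0) \<longrightarrow> R1 = {} \<or> R2 = {})"

definition marking ::
  "'v::real_vector set \<Rightarrow> ('v \<Rightarrow> 'v \<Rightarrow> real) \<Rightarrow> 'v set \<Rightarrow> 'v set \<Rightarrow> 'v \<Rightarrow> 'v \<Rightarrow> bool" where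
  "marking F B R G a \<delta> \<longleftrightarrow>
     subspace G \<and> dim G = 1 \<and> G \<subseteq> form_radical B F \<and>
     G \<inter> group_closure R = {of_int j *\<^sub>R a | j::int. True} \<and>
     group_closure R \<inter> form_radical B F =
       {of_int j *\<^sub>R a + of_int k *\<^sub>R \<delta> | (j::int) (k::int). True} \<and>
     (\<forall>(j::int) (k::int). of_int j *\<^sub>R a + of_int k *\<^sub>R \<delta> = 0 \<longrightarrow> j = 0 \<and> k = 0)"

(* The image of R in F/G is reduced: proportional images are equal up to sign. *)
definition reduced_mod :: "'v::real_vector set \<Rightarrow> 'v set \<Rightarrow> bool" where
  "reduced_mod G R \<longleftrightarrow> (\<forall>\<alpha>\<in>R. \<forall>\<beta>\<in>R. \<forall>t::real. \<beta> - t *\<^sub>R \<alpha> \<in> G \<longrightarrow> t = 1 \<or> t = -1)"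

(* The factor (I_R : I).  A lattice with all values B x x even is integral, by polarization. *)
definition even_scale :: "('v::real_vector \<Rightarrow> 'v \<Rightarrow> real) \<Rightarrow> 'v set \<Rightarrow> real \<Rightarrow> bool" where
  "even_scale B R \<kappa> \<longleftrightarrow>
     is_minimum {c. 0 < c \<and> (\<forall>x\<in>group_closure R. \<exists>k::int. c * B x x = 2 * of_int k)} \<kappa>"


section \<open>The hyperbolic extension, its isometries and the elliptic Weyl group\<close>

definition hyperbolic_extension ::
  "nat \<Rightarrow> ('v::euclidean_space \<Rightarrow> 'v \<Rightarrow> real) \<Rightarrow> 'v \<Rightarrow> 'v \<Rightarrow> 'v \<Rightarrow> bool" where
  "hyperbolic_extension l B a \<delta> \<Lambda>0 \<longleftrightarrow>
     DIM('v) = l + 3 \<and> bilinear B \<and> (\<forall>u v. B u v = B v u) \<and>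
     form_radical B UNIV = span {a} \<and> B \<Lambda>0 \<delta> = 1 \<and> B \<Lambda>0 \<Lambda>0 = 0"

(* O(tilde F, F, rad I).  Given bij_betw g F F, the restriction of g to F lies in GL(F). *)
definition ortho_group :: "'v::real_vector set \<Rightarrow> ('v \<Rightarrow> 'v \<Rightarrow> real) \<Rightarrow> ('v \<Rightarrow> 'v) set" where
  "ortho_group F B = {g. linear g \<and> bij g \<and> (\<forall>u v. B (g u) (g v) = B u v) \<and>
     bij_betw g F F \<and> (\<forall>u\<in>form_radical B F. g u = u)}"

definition restriction_kernel :: "'v::real_vector set \<Rightarrow> ('v \<Rightarrow> 'v \<Rightarrow> real) \<Rightarrow> ('v \<Rightarrow> 'v) set" where
  "restriction_kernel F B = {g\<in>ortho_group F B. \<forall>u\<in>F. g u = u}"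

inductive_set weyl_group :: "('v::real_vector \<Rightarrow> 'v \<Rightarrow> real) \<Rightarrow> 'v set \<Rightarrow> ('v \<Rightarrow> 'v) set"
  for B R where
  one: "id \<in> weyl_group B R"
| reflection: "\<alpha> \<in> R \<Longrightarrow> root_reflection B \<alpha> \<in> weyl_group B R"
| mult: "g \<in> weyl_group B R \<Longrightarrow> h \<in> weyl_group B R \<Longrightarrow> g \<circ> h \<in> weyl_group B R"
| inverse: "g \<in> weyl_group B R \<Longrightarrow> inv g \<in> weyl_group B R"


section \<open>Exponents\<close>

(* The images of \<alpha>0, ..., \<alpha>l form a base of the image of R in F/G: they are linearly independent
   and every root is, modulo G, a nonnegative or a nonpositive integral combination of them. *)
definition simple_root_lifts ::
  "nat \<Rightarrow> 'v::real_vector set \<Rightarrow> 'v set \<Rightarrow> (nat \<Rightarrow> 'v) \<Rightarrow> bool" where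
  "simple_root_lifts l R G \<alpha>s \<longleftrightarrow>
     (\<forall>i\<le>l. \<alpha>s i \<in> R) \<and>
     (\<forall>c::nat \<Rightarrow> real. (\<Sum>i\<le>l. c i *\<^sub>R \<alpha>s i) \<in> G \<longrightarrow> (\<forall>i\<le>l. c i = 0)) \<and>
     (\<forall>\<beta>\<in>R. \<exists>c::nat \<Rightarrow> nat. \<beta> - (\<Sum>i\<le>l. of_nat (c i) *\<^sub>R \<alpha>s i) \<in> G \<or>
                             \<beta> + (\<Sum>i\<le>l. of_nat (c i) *\<^sub>R \<alpha>s i) \<in> G)"

definition null_root_coeffs ::
  "nat \<Rightarrow> 'v::real_vector set \<Rightarrow> 'v \<Rightarrow> (nat \<Rightarrow> 'v) \<Rightarrow> (nat \<Rightarrow> nat) \<Rightarrow> bool" where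
  "null_root_coeffs l G \<delta> \<alpha>s ns \<longleftrightarrow>
     (\<forall>i\<le>l. 0 < ns i) \<and> Gcd (ns ` {..l}) = 1 \<and>
     ((\<Sum>i\<le>l. of_nat (ns i) *\<^sub>R \<alpha>s i) - \<delta> \<in> G \<or> (\<Sum>i\<le>l. of_nat (ns i) *\<^sub>R \<alpha>s i) + \<delta> \<in> G)"

definition root_counter :: "'v::real_vector set \<Rightarrow> 'v \<Rightarrow> 'v \<Rightarrow> nat" where
  "root_counter R a \<alpha> = (LEAST k. 0 < k \<and> \<alpha> + of_nat k *\<^sub>R a \<in> R)"

definition exponent_list ::
  "nat \<Rightarrow> ('v::real_vector \<Rightarrow> 'v \<Rightarrow> real) \<Rightarrow> 'v set \<Rightarrow> 'v \<Rightarrow> real \<Rightarrow> (nat \<Rightarrow> 'v) \<Rightarrow> (nat \<Rightarrow> nat) \<Rightarrow> real list"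
  where
  "exponent_list l B R a \<kappa> \<alpha>s ns =
     sort (map (\<lambda>i. \<kappa> * B (\<alpha>s i) (\<alpha>s i) * real (ns i) / (2 * real (root_counter R a (\<alpha>s i)))) [0..<l+1])"

definition exponents ::
  "nat \<Rightarrow> ('v::real_vector \<Rightarrow> 'v \<Rightarrow> real) \<Rightarrow> 'v set \<Rightarrow> 'v set \<Rightarrow> 'v \<Rightarrow> 'v \<Rightarrow> real \<Rightarrow> (nat \<Rightarrow> real) \<Rightarrow> bool"
  where
  "exponents l B R G a \<delta> \<kappa> m \<longleftrightarrow>
     (\<exists>\<alpha>s ns. simple_root_lifts l R G \<alpha>s \<and> null_root_coeffs l G \<delta> \<alpha>s ns \<and>
              (\<forall>i\<le>l. m i = exponent_list l B R a \<kappa> \<alpha>s ns ! i))"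

(* d (l+1) = d_n is the smallest common denominator of the m_i / m_max, where m_max = m l. *)
definition degrees :: "nat \<Rightarrow> (nat \<Rightarrow> real) \<Rightarrow> (nat \<Rightarrow> nat) \<Rightarrow> bool" where
  "degrees l m d \<longleftrightarrow>
     is_minimum {N::nat. 0 < N \<and> (\<forall>i\<le>l. real N * (m i / m l) \<in> \<int>)} (d (l+1)) \<and>
     (\<forall>\<alpha>\<in>{1..l+1}. real (d \<alpha>) = m (\<alpha> - 1) * real (d (l+1)) / m l)"


section \<open>Semisimplicity and Jordan decomposition\<close>

definition semisimple_on :: "'v::real_vector set \<Rightarrow> ('v \<Rightarrow> 'v) \<Rightarrow> bool" where
  "semisimple_on S g \<longleftrightarrow> subspace S \<and> linear g \<and> g ` S \<subseteq> S \<and>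
     (\<forall>U. subspace U \<and> U \<subseteq> S \<and> g ` U \<subseteq> U \<longrightarrow>
        (\<exists>T. subspace T \<and> T \<subseteq> S \<and> g ` T \<subseteq> T \<and> U \<inter> T = {0} \<and> {u + t | u t. u \<in> U \<and> t \<in> T} = S))"

definition unipotent :: "('v::real_vector \<Rightarrow> 'v) \<Rightarrow> bool" where
  "unipotent g \<longleftrightarrow> linear g \<and> (\<exists>k. ((\<lambda>u. g u - u) ^^ k) = (\<lambda>u. 0))"

definition jordan_decomposition ::
  "('v::real_vector \<Rightarrow> 'v) \<Rightarrow> ('v \<Rightarrow> 'v) \<Rightarrow> ('v \<Rightarrow> 'v) \<Rightarrow> bool" where
  "jordan_decomposition g s u \<longleftrightarrow>
     semisimple_on UNIV s \<and> unipotent u \<and> g = s \<circ> u \<and> s \<circ> u = u \<circ> s"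


section \<open>Hyperbolic Coxeter transformations\<close>

(* Eigenspace of the complexification of g on S \<otimes> \<complex>; the pair (u, v) stands for u + i v,
   so the real dimension is twice the complex one. *)
definition complex_eigenspace ::
  "'v::real_vector set \<Rightarrow> ('v \<Rightarrow> 'v) \<Rightarrow> complex \<Rightarrow> ('v \<times> 'v) set" where
  "complex_eigenspace S g z = {(u, v). u \<in> S \<and> v \<in> S \<and>
     g u = Re z *\<^sub>R u - Im z *\<^sub>R v \<and> g v = Im z *\<^sub>R u + Re z *\<^sub>R v}"

(* The eigenvalues 1, exp (2 pi i d_1 / d_n), ..., exp (2 pi i d_n / d_n) are listed with
   multiplicity; there are n + 1 = dim F of them. *)
definition hyperbolic_coxeter ::
  "nat \<Rightarrow> 'v::real_vector set \<Rightarrow> ('v \<Rightarrow> 'v \<Rightarrow> real) \<Rightarrow> 'v set \<Rightarrow> 'v \<Rightarrow> 'v \<Rightarrow> real \<Rightarrow> (nat \<Rightarrow> real) \<Rightarrow> (nat \<Rightarrow> nat)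
     \<Rightarrow> ('v \<Rightarrow> 'v) \<Rightarrow> bool" where
  "hyperbolic_coxeter l F B R a \<delta> \<kappa> m d c \<longleftrightarrow>
     c \<in> weyl_group B R \<and>
     semisimple_on F c \<and>
     is_minimum {k. 0 < k \<and> (\<forall>u\<in>F. (c ^^ k) u = u)} (d (l+1)) \<and>
     (\<forall>z. dim (complex_eigenspace F c z) =
        2 * (of_bool (z = 1) +
             card {\<alpha>\<in>{1..l+1}. exp (2 * of_real pi * \<i> * of_nat (d \<alpha>) / of_nat (d (l+1))) = z})) \<and>
     R \<inter> (\<lambda>u. c u - u) ` F = {} \<and>
     (\<forall>\<xi>. c \<xi> - \<xi> + (\<kappa> * B \<xi> \<delta> / m l) *\<^sub>R a \<in> (\<lambda>u. c u - u) ` F) \<and>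
     weyl_group B R \<inter> restriction_kernel F B =
       (\<Union>k. {(c ^^ d (l+1)) ^^ k, inv (c ^^ d (l+1)) ^^ k})"


section \<open>The domain Y and the invariant ring\<close>

definition cscale :: "complex \<Rightarrow> ('v::real_normed_vector \<Rightarrow>\<^sub>L complex) \<Rightarrow> ('v \<Rightarrow>\<^sub>L complex)" where
  "cscale z x = Blinfun (\<lambda>\<gamma>. z * blinfun_apply x \<gamma>)"

definition dom_Y :: "'v::euclidean_space \<Rightarrow> 'v \<Rightarrow> ('v \<Rightarrow>\<^sub>L complex) set" where
  "dom_Y a \<delta> = {x. blinfun_apply x a = - 2 * of_real pi * \<i> \<and> 0 < Re (blinfun_apply x \<delta>)}"

definition act_Y :: "('v::euclidean_space \<Rightarrow> 'v) \<Rightarrow> ('v \<Rightarrow>\<^sub>L complex) \<Rightarrow> ('v \<Rightarrow>\<^sub>L complex)" where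
  "act_Y g x = Blinfun (\<lambda>\<gamma>. blinfun_apply x (inv g \<gamma>))"

definition act_fun ::
  "('v::euclidean_space \<Rightarrow> 'v) \<Rightarrow> (('v \<Rightarrow>\<^sub>L complex) \<Rightarrow> complex) \<Rightarrow> ('v \<Rightarrow>\<^sub>L complex) \<Rightarrow> complex" where
  "act_fun g f x = f (act_Y (inv g) x)"

(* F(Y): complex differentiability on Y, an open subset of a complex affine hyperplane whose
   directions are the v with v(a) = 0.  Here and below functions on Y are functions on the whole
   dual space whose values outside Y are irrelevant; equations between them are stated on Y. *)
definition holo_Y :: "'v::euclidean_space \<Rightarrow> 'v \<Rightarrow> (('v \<Rightarrow>\<^sub>L complex) \<Rightarrow> complex) set" where
  "holo_Y a \<delta> = {f. \<forall>x\<in>dom_Y a \<delta>. \<exists>D. (f has_derivative D) (at x within dom_Y a \<delta>) \<and>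
     (\<forall>v z. blinfun_apply v a = 0 \<longrightarrow> D (cscale z v) = z * D v)}"

(* H, a set of real-linear maps rad I \<rightarrow> \<complex>, represented as extensional functions on N = rad I. *)
definition dom_H :: "'v::real_vector set \<Rightarrow> 'v \<Rightarrow> 'v \<Rightarrow> ('v \<Rightarrow> complex) set" where
  "dom_H N a \<delta> = {y\<in>extensional N. (\<forall>u\<in>N. \<forall>v\<in>N. y (u + v) = y u + y v) \<and>
     (\<forall>u\<in>N. \<forall>r::real. y (r *\<^sub>R u) = r *\<^sub>R y u) \<and>
     y a = - 2 * of_real pi * \<i> \<and> 0 < Re (y \<delta>)}"

definition proj_H :: "'v::euclidean_space set \<Rightarrow> ('v \<Rightarrow>\<^sub>L complex) \<Rightarrow> ('v \<Rightarrow> complex)" where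
  "proj_H N x = restrict (blinfun_apply x) N"

(* F(H): as rad I is spanned by a and \<delta>, the coordinate y \<mapsto> y \<delta> identifies H with the right
   half plane. *)
definition holo_H :: "'v::real_vector set \<Rightarrow> 'v \<Rightarrow> 'v \<Rightarrow> (('v \<Rightarrow> complex) \<Rightarrow> complex) set" where
  "holo_H N a \<delta> = {h. \<exists>\<phi>. \<phi> holomorphic_on {z. 0 < Re z} \<and> (\<forall>y\<in>dom_H N a \<delta>. h y = \<phi> (y \<delta>))}"

(* The Euler field is a constant vector field on Y: its value on the coordinate function \<gamma> \<in> tilde F
   is e(\<gamma>), and it differentiates functions in the direction e. *)
definition euler_vector ::
  "nat \<Rightarrow> 'v::euclidean_space set \<Rightarrow> 'v \<Rightarrow> real \<Rightarrow> (nat \<Rightarrow> real) \<Rightarrow> (nat \<Rightarrow> nat) \<Rightarrow> ('v \<Rightarrow>\<^sub>L complex) \<Rightarrow> bool" where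
  "euler_vector l F \<Lambda>0 \<kappa> m d e \<longleftrightarrow>
     (\<forall>u\<in>F. blinfun_apply e u = 0) \<and>
     blinfun_apply e \<Lambda>0 = of_real (\<kappa> * real (d (l+1)) / m l)"

definition euler_field ::
  "('v::euclidean_space \<Rightarrow>\<^sub>L complex) \<Rightarrow> (('v \<Rightarrow>\<^sub>L complex) \<Rightarrow> complex) \<Rightarrow> ('v \<Rightarrow>\<^sub>L complex) \<Rightarrow> complex" where
  "euler_field e f x = deriv (\<lambda>t. f (x + cscale t e)) 0"

definition inv_degree ::
  "('v::euclidean_space \<Rightarrow> 'v \<Rightarrow> real) \<Rightarrow> 'v set \<Rightarrow> 'v \<Rightarrow> 'v \<Rightarrow> ('v \<Rightarrow>\<^sub>L complex) \<Rightarrow> nat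
     \<Rightarrow> (('v \<Rightarrow>\<^sub>L complex) \<Rightarrow> complex) set" where
  "inv_degree B R a \<delta> e m = {f\<in>holo_Y a \<delta>.
     (\<forall>g\<in>weyl_group B R. \<forall>x\<in>dom_Y a \<delta>. act_fun g f x = f x) \<and>
     (\<forall>x\<in>dom_Y a \<delta>. euler_field e f x = of_nat m * f x)}"

definition inv_ring ::
  "('v::euclidean_space \<Rightarrow> 'v \<Rightarrow> real) \<Rightarrow> 'v set \<Rightarrow> 'v \<Rightarrow> 'v \<Rightarrow> ('v \<Rightarrow>\<^sub>L complex)
     \<Rightarrow> (('v \<Rightarrow>\<^sub>L complex) \<Rightarrow> complex) set" where
  "inv_ring B R a \<delta> e = {f. \<exists>N f'. (\<forall>m\<le>N. f' m \<in> inv_degree B R a \<delta> e m) \<and>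
     (\<forall>x\<in>dom_Y a \<delta>. f x = (\<Sum>m\<le>N. f' m x))}"

(* Value at y of the polynomial in x^1, ..., x^n with coefficients h \<nu>, pulled back from H, and
   exponent vectors \<nu> \<in> P. *)
definition poly_value ::
  "nat \<Rightarrow> 'v::euclidean_space set \<Rightarrow> (nat \<Rightarrow> ('v \<Rightarrow>\<^sub>L complex) \<Rightarrow> complex) \<Rightarrow> (nat \<Rightarrow> nat) set
     \<Rightarrow> ((nat \<Rightarrow> nat) \<Rightarrow> ('v \<Rightarrow> complex) \<Rightarrow> complex) \<Rightarrow> ('v \<Rightarrow>\<^sub>L complex) \<Rightarrow> complex" where
  "poly_value n N x P h y = (\<Sum>\<nu>\<in>P. h \<nu> (proj_H N y) * (\<Prod>\<alpha>=1..n. x \<alpha> y ^ \<nu> \<alpha>))"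

definition basic_invariants ::
  "nat \<Rightarrow> 'v::euclidean_space set \<Rightarrow> ('v \<Rightarrow> 'v \<Rightarrow> real) \<Rightarrow> 'v set \<Rightarrow> 'v \<Rightarrow> 'v \<Rightarrow> ('v \<Rightarrow>\<^sub>L complex) \<Rightarrow> (nat \<Rightarrow> nat)
     \<Rightarrow> (nat \<Rightarrow> ('v \<Rightarrow>\<^sub>L complex) \<Rightarrow> complex) \<Rightarrow> bool" where
  "basic_invariants l F B R a \<delta> e d x \<longleftrightarrow>
     (let n = l + 1; N = form_radical B F; FH = holo_H N a \<delta> in
      0 < d 1 \<and> mono_on {1..n} d \<and>
      (\<forall>\<alpha>\<in>{1..n}. x \<alpha> \<in> inv_degree B R a \<delta> e (d \<alpha>)) \<and>
      inv_ring B R a \<delta> e =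
        {f. \<exists>P h. finite P \<and> P \<subseteq> {1..n} \<rightarrow>\<^sub>E UNIV \<and> (\<forall>\<nu>\<in>P. h \<nu> \<in> FH) \<and>
                  (\<forall>y\<in>dom_Y a \<delta>. f y = poly_value n N x P h y)} \<and>
      (\<forall>P h. finite P \<and> P \<subseteq> {1..n} \<rightarrow>\<^sub>E UNIV \<and> (\<forall>\<nu>\<in>P. h \<nu> \<in> FH) \<and>
             (\<forall>y\<in>dom_Y a \<delta>. poly_value n N x P h y = 0) \<longrightarrow>
             (\<forall>\<nu>\<in>P. \<forall>y\<in>dom_H N a \<delta>. h \<nu> y = 0)))"


section \<open>Admissible triplets\<close>

definition primitive_root_of_unity :: "nat \<Rightarrow> complex \<Rightarrow> bool" where
  "primitive_root_of_unity N z \<longleftrightarrow> is_minimum {k. 0 < k \<and> z ^ k = 1} N"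

definition regular_complement ::
  "'v::real_vector set \<Rightarrow> ('v \<Rightarrow> 'v \<Rightarrow> real) \<Rightarrow> 'v set \<Rightarrow> ('v \<Rightarrow> 'v) \<Rightarrow> 'v set \<Rightarrow> bool" where
  "regular_complement F B R g L \<longleftrightarrow>
     subspace L \<and> L \<inter> form_radical B F = {0} \<and> {u + v | u v. u \<in> L \<and> v \<in> form_radical B F} = UNIV \<and>
     g ` L = L \<and> L \<inter> R = {}"

definition admissible_triplet ::
  "nat \<Rightarrow> 'v::euclidean_space set \<Rightarrow> ('v \<Rightarrow> 'v \<Rightarrow> real) \<Rightarrow> 'v set \<Rightarrow> 'v \<Rightarrow> 'v \<Rightarrow> ('v \<Rightarrow>\<^sub>L complex) \<Rightarrow> (nat \<Rightarrow> nat)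
     \<Rightarrow> ('v \<Rightarrow> 'v) \<Rightarrow> complex \<Rightarrow> 'v set \<Rightarrow> bool" where
  "admissible_triplet l F B R a \<delta> e d g \<zeta> L \<longleftrightarrow>
     g \<in> ortho_group F B \<and> \<zeta> \<noteq> 0 \<and>
     semisimple_on UNIV g \<and> (\<forall>u. g u - u \<in> F) \<and>
     primitive_root_of_unity (d (l+1)) \<zeta> \<and>
     (\<exists>x. basic_invariants l F B R a \<delta> e d x \<and>
          (\<forall>\<alpha>\<in>{1..l+1}. \<forall>y\<in>dom_Y a \<delta>. act_fun g (x \<alpha>) y = \<zeta> ^ d \<alpha> * x \<alpha> y)) \<and>
     regular_complement F B R g L"

end

(* Since c^N is the identity on F, where N = d_n, the map T = c^N - 1 kills F; as c displaces
   vectors inside F, T maps into rad I, so T^2 = 0.  The N-th power of the semisimple part s of c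
   is both unipotent and semisimple, hence trivial, so the unipotent part is the unipotent N-th
   root 1 + T/N of c^N.  Thus s = c (1 - T/N), and 1 - T/N is an isometry acting trivially on F
   with displacements in rad I. *)
theory Submission
  imports Defs
begin

section \<open>Commuting linear maps and unipotence\<close>

lemma funpow_commute:
  assumes "f \<circ> g = g \<circ> f"
  shows "(f ^^ k) \<circ> g = g \<circ> (f ^^ k)"
  using assms by (induction k) (auto simp: fun_eq_iff)

lemma comp_funpow_commute:
  assumes "f \<circ> g = g \<circ> f"
  shows "(f \<circ> g) ^^ k = (f ^^ k) \<circ> (g ^^ k)"
proof (induction k)
  case (Suc k)
  then show ?case
    using funpow_commute[OF assms, of k] by (simp add: fun_eq_iff)
qed simp

lemma linear_funpow:
  fixes f :: "'a::real_vector \<Rightarrow> 'a"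
  assumes "linear f"
  shows "linear (f ^^ k)"
proof (induction k)
  case 0
  show ?case by (simp add: linear_id[unfolded id_def] id_def)
next
  case (Suc k)
  show ?case unfolding funpow.simps by (rule linear_compose[OF Suc assms])
qed

text \<open>An induction on i + j replaces the binomial expansion of (f + g)^(i + j). It is
  pointwise because it passes from x to f x and g x: f x needs one power of f less and, by
  commutation, is still killed by g^j; symmetrically for g x.\<close>

lemma funpow_add_commuting_eq_0:
  fixes f g :: "'a::real_vector \<Rightarrow> 'a"
  assumes f: "linear f" and g: "linear g" and fg: "f \<circ> g = g \<circ> f"
  shows "(f ^^ i) x = 0 \<Longrightarrow> (g ^^ j) x = 0 \<Longrightarrow> ((\<lambda>y. f y + g y) ^^ (i + j)) x = 0"
proof (induction "i + j" arbitrary: i j x)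
  case 0
  then show ?case by simp
next
  case (Suc p)
  let ?h = "\<lambda>y. f y + g y"
  have h: "linear (?h ^^ k)" for k
    by (intro linear_funpow linear_compose_add f g)
  show ?case
  proof (cases "i = 0 \<or> j = 0")
    case True
    \<comment> \<open>A zero exponent turns one of the two premises into x = 0.\<close>
    then have "x = 0" using Suc.prems by auto
    then show ?thesis using linear_0[OF h] by simp
  next
    case False
    then obtain i' j' where ij: "i = Suc i'" "j = Suc j'"
      by (metis not0_implies_Suc)
    have "(g ^^ j) (f x) = 0" "(f ^^ i) (g x) = 0"
      using funpow_commute[OF fg, of i] funpow_commute[OF fg[symmetric], of j] Suc.prems
        linear_0[OF f] linear_0[OF g]
      by (simp_all add: fun_eq_iff)
    moreover have "(f ^^ i') (f x) = 0" "(g ^^ j') (g x) = 0"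
      using Suc.prems by (simp_all add: ij funpow_swap1)
    ultimately have "(?h ^^ (i' + j)) (f x) = 0" "(?h ^^ (i + j')) (g x) = 0"
      using Suc.hyps(1)[of i' j "f x"] Suc.hyps(1)[of i j' "g x"] Suc.hyps(2)
      by (simp_all add: ij)
    then have "(?h ^^ p) (f x) = 0" "(?h ^^ p) (g x) = 0"
      using Suc.hyps(2) by (simp_all add: ij)
    then have "(?h ^^ Suc p) x = 0"
      using linear_add[OF h, of p "f x" "g x"] unfolding funpow_Suc_right by simp
    then show ?thesis using Suc.hyps(2) by simp
  qed
qed

lemma nilpotent_add:
  fixes f g :: "'a::real_vector \<Rightarrow> 'a"
  assumes "linear f" "linear g" "f \<circ> g = g \<circ> f"
    and "f ^^ i = (\<lambda>x. 0)" "g ^^ j = (\<lambda>x. 0)"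
  shows "(\<lambda>x. f x + g x) ^^ (i + j) = (\<lambda>x. 0)"
  by (rule ext) (rule funpow_add_commuting_eq_0[OF assms(1-3)], simp_all add: assms)

lemma nilpotent_comp:
  fixes f g :: "'a::real_vector \<Rightarrow> 'a"
  assumes "f \<circ> g = g \<circ> f" and "f ^^ i = (\<lambda>x. 0)"
  shows "(f \<circ> g) ^^ i = (\<lambda>x. 0)"
  unfolding comp_funpow_commute[OF assms(1)] assms(2) by (simp add: comp_def)

text \<open>The identity f g - 1 = (f - 1) g + (g - 1) splits the displacement into two commuting
  nilpotent summands.\<close>

lemma unipotent_comp:
  assumes "unipotent f" "unipotent g" and fg: "f \<circ> g = g \<circ> f"
  shows "unipotent (f \<circ> g)"
proof -
  let ?F = "\<lambda>x. f x - x" and ?G = "\<lambda>x. g x - x"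
  have lin: "linear f" "linear g" using assms by (auto simp: unipotent_def)
  obtain i j where ij: "?F ^^ i = (\<lambda>x. 0)" "?G ^^ j = (\<lambda>x. 0)"
    using assms by (auto simp: unipotent_def)
  have FG: "?F \<circ> g = g \<circ> ?F" "(?F \<circ> g) \<circ> ?G = ?G \<circ> (?F \<circ> g)"
    using fg by (auto simp: fun_eq_iff linear_diff[OF lin(1)] linear_diff[OF lin(2)])
  have "linear ?F" "linear ?G" by (intro linear_compose_sub linear_ident lin)+
  then have "(\<lambda>x. (?F \<circ> g) x + ?G x) ^^ (i + j) = (\<lambda>x. 0)"
    using nilpotent_comp[OF FG(1) ij(1)]
    by (intro nilpotent_add FG(2) ij linear_compose[OF lin(2)])
  then show ?thesis
    using lin by (auto simp: unipotent_def linear_compose)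
qed

lemma unipotent_funpow:
  fixes f :: "'a::real_vector \<Rightarrow> 'a"
  assumes "unipotent f"
  shows "unipotent (f ^^ k)"
proof (induction k)
  case 0
  have "((\<lambda>u::'a. id u - u) ^^ 1) = (\<lambda>u. 0)" by simp
  then show ?case unfolding unipotent_def funpow.simps using linear_id by blast
next
  case (Suc k)
  show ?case
    unfolding funpow.simps
    by (rule unipotent_comp[OF assms Suc funpow_commute[OF refl, symmetric]])
qed

section \<open>Rigidity of unipotent maps of finite order and of semisimple maps\<close>

lemma unipotent_finite_order_imp_id:
  assumes "unipotent w" and "N > 0" and wN: "w ^^ N = id"
  shows "w = id"
proof -
  let ?n = "\<lambda>x. w x - x"
  have lin: "linear w" using assms by (simp add: unipotent_def)
  then have n: "linear ?n" by (intro linear_compose_sub linear_ident)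
  obtain k where k: "?n ^^ k = (\<lambda>x. 0)" using assms by (auto simp: unipotent_def)
  \<comment> \<open>Where n = w - 1 squares to zero, w^j = (1 + n)^j is 1 + j n. Taking j = N gives
    N n y = 0, hence n y = 0 because N > 0.\<close>
  have fixed: "(w ^^ j) y = y + real j *\<^sub>R ?n y" if "?n (?n y) = 0" for j y
  proof (induction j)
    case (Suc j)
    have "(w ^^ Suc j) y = w y + real j *\<^sub>R (w (w y) - w y)"
      using Suc by (simp add: linear_add[OF lin] linear_scale[OF lin] linear_diff[OF lin])
    also have "w (w y) - w y = ?n y"
      using that by (simp add: linear_diff[OF lin])
    finally show ?case by (simp add: algebra_simps)
  qed simp
  have step: "?n y = 0" if "?n (?n y) = 0" for y
    using fixed[OF that, of N] wN \<open>N > 0\<close> by simp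
  \<comment> \<open>So the kernel of n^2 equals that of n, and the kernels of all powers n^j
    collapse to it; nilpotency then gives n = 0.\<close>
  have ker: "?n x = 0" if "(?n ^^ j) x = 0" for j x
    using that
  proof (induction j arbitrary: x)
    case 0
    then show ?case by (simp add: linear_0[OF lin])
  next
    case (Suc j)
    then have "(?n ^^ j) (?n x) = 0" unfolding funpow_Suc_right by simp
    then show ?case by (rule step[OF Suc.IH])
  qed
  have "?n x = 0" for x by (rule ker[of k]) (simp add: k)
  then show ?thesis by (simp add: fun_eq_iff)
qed

text \<open>The fixed space U of s^N is stable under s, so semisimplicity supplies a stable
  complement T. On T the map s^N - 1 is both nilpotent and injective, which forces T = 0.\<close>

lemma semisimple_funpow_unipotent_imp_id:
  assumes ss: "semisimple_on UNIV s" and uni: "unipotent (s ^^ N)"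
  shows "s ^^ N = id"
proof -
  let ?n = "\<lambda>x. (s ^^ N) x - x"
  let ?U = "{x. ?n x = 0}"
  have s: "linear s" using ss by (simp add: semisimple_on_def)
  have n: "linear ?n" by (intro linear_compose_sub linear_ident linear_funpow s)
  have sn: "s (?n x) = ?n (s x)" for x
    by (simp add: linear_diff[OF s] funpow_swap1)
  have "subspace ?U"
    using linear_subspace_kernel[OF n] by simp
  moreover have "s ` ?U \<subseteq> ?U"
  proof (intro image_subsetI CollectI)
    fix x assume "x \<in> ?U"
    then show "?n (s x) = 0" using linear_0[OF s] unfolding sn[symmetric] by simp
  qed
  ultimately obtain T where T: "subspace T" "s ` T \<subseteq> T" "?U \<inter> T = {0}"
      "{u + t | u t. u \<in> ?U \<and> t \<in> T} = UNIV"
    using ss[unfolded semisimple_on_def, THEN conjunct2, THEN conjunct2, THEN conjunct2,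
        THEN spec, of ?U] by blast
  have sT: "(s ^^ k) t \<in> T" if "t \<in> T" for k t
    using that T(2) by (induction k) auto
  have nT: "?n t \<in> T" if "t \<in> T" for t
    by (rule subspace_diff[OF T(1) sT[OF that] that])
  obtain k where k: "?n ^^ k = (\<lambda>x. 0)" using uni by (auto simp: unipotent_def)
  have ker: "t = 0" if "t \<in> T" "(?n ^^ j) t = 0" for j t
    using that
  proof (induction j arbitrary: t)
    case (Suc j)
    then have "(?n ^^ j) (?n t) = 0" unfolding funpow_Suc_right by simp
    then have "?n t = 0" using Suc.IH nT Suc.prems(1) by blast
    then show ?case using T(3) Suc.prems(1) by blast
  qed simp
  have T0: "t = 0" if "t \<in> T" for t by (rule ker[OF that, of k]) (simp add: k)
  have "(s ^^ N) x = x" for x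
  proof -
    have "x \<in> {u + t | u t. u \<in> ?U \<and> t \<in> T}" unfolding T(4) by (rule UNIV_I)
    then obtain u t where "x = u + t" "u \<in> ?U" "t \<in> T" by blast
    then show ?thesis using T0[of t] by simp
  qed
  then show ?thesis by (simp add: fun_eq_iff)
qed

text \<open>Hypothesis \<open>sq\<close> says T^2 = 0 for T = c^N - 1. The second conclusion
  expresses \<open>s\<close> through \<open>c\<close> alone, so that geometric properties of
  \<open>c\<close> can be transferred to it.\<close>

lemma jordan_semisimple_part:
  assumes jd: "jordan_decomposition c s u"
    and "N > 0"
    and sq: "\<And>x. (c ^^ N) ((c ^^ N) x - x) = (c ^^ N) x - x"
  shows "s ^^ N = id"
    and "s x = c (x - (1 / real N) *\<^sub>R ((c ^^ N) x - x))"
proof -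
  let ?T = "\<lambda>x. (c ^^ N) x - x"
  let ?r = "\<lambda>x. x - (1 / real N) *\<^sub>R ?T x"
  have ss: "semisimple_on UNIV s" and uni: "unipotent u" and c: "c = s \<circ> u"
    and su: "s \<circ> u = u \<circ> s"
    using jd by (auto simp: jordan_decomposition_def)
  have s: "linear s" using ss by (simp add: semisimple_on_def)
  have u: "linear u" using uni by (simp add: unipotent_def)
  have lc: "linear c" unfolding c by (rule linear_compose[OF u s])
  have T: "linear ?T" by (intro linear_compose_sub linear_ident linear_funpow lc)
  have TT: "?T (?T x) = 0" for x using sq by simp
  have cs: "c \<circ> s = s \<circ> c" and cu: "c \<circ> u = u \<circ> c"
    unfolding c using su by (auto simp: fun_eq_iff)
  have cN: "(c ^^ N) x = (s ^^ N) ((u ^^ N) x)" for x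
    using comp_funpow_commute[OF su] by (simp add: c)
  have sNuN: "s ^^ N \<circ> (u ^^ N) = u ^^ N \<circ> (s ^^ N)"
    by (intro funpow_commute funpow_commute[symmetric] su)
  have cNsN: "c ^^ N \<circ> (s ^^ N) = s ^^ N \<circ> (c ^^ N)"
    by (intro funpow_commute funpow_commute[symmetric] cs)
  have cNuN: "c ^^ N \<circ> (u ^^ N) = u ^^ N \<circ> (c ^^ N)"
    by (intro funpow_commute funpow_commute[symmetric] cu)
  have lsN: "linear (s ^^ N)" and luN: "linear (u ^^ N)" and lcN: "linear (c ^^ N)"
    by (simp_all add: linear_funpow s u lc)
  show sN: "s ^^ N = id"
  proof (rule semisimple_funpow_unipotent_imp_id[OF ss])
    \<comment> \<open>Without inverting u: s^N - 1 = T - (u^N - 1) s^N, a sum of two commuting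
      nilpotent maps.\<close>
    let ?A = "\<lambda>x. (u ^^ N) x - x" and ?m = "\<lambda>x. - (s ^^ N) x"
    obtain k where k: "?A ^^ k = (\<lambda>x. 0)"
      using unipotent_funpow[OF uni] by (auto simp: unipotent_def)
    have A: "linear ?A" by (intro linear_compose_sub linear_ident luN)
    have m: "linear ?m" by (intro linear_compose_neg lsN)
    have Am: "?A \<circ> ?m = ?m \<circ> ?A"
      using sNuN by (auto simp: fun_eq_iff linear_neg[OF luN] linear_diff[OF lsN])
    have "?T \<circ> (?A \<circ> ?m) = (?A \<circ> ?m) \<circ> ?T"
      using cNsN cNuN
      by (auto simp: fun_eq_iff linear_neg[OF luN] linear_neg[OF lcN] linear_diff[OF lsN]
          linear_diff[OF luN] linear_diff[OF lcN])
    moreover have "?T ^^ 2 = (\<lambda>x. 0)"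
      using TT by (simp add: fun_eq_iff numeral_2_eq_2)
    ultimately have "(\<lambda>x. ?T x + (?A \<circ> ?m) x) ^^ (2 + k) = (\<lambda>x. 0)"
      using nilpotent_comp[OF Am k] by (intro nilpotent_add T linear_compose[OF m A])
    moreover have "(\<lambda>x. ?T x + (?A \<circ> ?m) x) = (\<lambda>x. (s ^^ N) x - x)"
      using sNuN by (simp add: cN fun_eq_iff linear_neg[OF luN])
    ultimately show "unipotent (s ^^ N)"
      using lsN unfolding unipotent_def by metis
  qed
  have r: "linear ?r" by (intro linear_compose_sub linear_ident linear_compose_scale_right T)
  \<comment> \<open>From T^2 = 0 follows T r = T for r = 1 - T/N, so the powers of r are 1 - (k/N)
    T; in particular r^N = 1 - T.\<close>
  have Tr: "?T (?r x) = ?T x" for x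
    unfolding linear_diff[OF T, of x] linear_scale[OF T] TT by simp
  have rpow: "(?r ^^ k) x = x - (real k / real N) *\<^sub>R ?T x" for k x
  proof (induction k arbitrary: x)
    case (Suc k)
    have "(?r ^^ Suc k) x = ?r x - (real k / real N) *\<^sub>R ?T (?r x)"
      by (simp only: funpow_Suc_right comp_apply Suc)
    then show ?case unfolding Tr by (simp add: algebra_simps add_divide_distrib)
  qed simp
  \<comment> \<open>u commutes with c, hence with T and with r.\<close>
  have ur: "u \<circ> ?r = ?r \<circ> u"
    using funpow_commute[OF cu, of N]
    by (auto simp: fun_eq_iff linear_diff[OF u] linear_scale[OF u])
  have "(\<lambda>x. ?r x - x) ^^ 2 = (\<lambda>x. 0)"
    using TT linear_scale[OF T, of "- 1 / real N"] by (simp add: fun_eq_iff numeral_2_eq_2)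
  then have "unipotent ?r" using r by (auto simp: unipotent_def)
  then have "unipotent (u \<circ> ?r)" by (intro unipotent_comp uni ur)
  moreover have "(u \<circ> ?r) ^^ N = id"
  proof
    fix x
    \<comment> \<open>As s^N = 1, u^N equals c^N = 1 + T, and (1 + T)(1 - T) = 1. Thus u r is
      unipotent of finite order, so u r = 1 and s = s u r = c r.\<close>
    have "((u \<circ> ?r) ^^ N) x = (u ^^ N) (x - ?T x)"
      using comp_funpow_commute[OF ur] rpow[of N] \<open>N > 0\<close> by simp
    also have "\<dots> = (c ^^ N) (x - ?T x)" by (simp add: cN sN)
    also have "\<dots> = id x" using sq[of x] by (simp add: linear_diff[OF lcN])
    finally show "((u \<circ> ?r) ^^ N) x = id x" .
  qed
  ultimately have "u \<circ> ?r = id"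
    using unipotent_finite_order_imp_id \<open>N > 0\<close> by blast
  then show "s x = c (?r x)" by (simp add: c fun_eq_iff)
qed


section \<open>Isometries with displacements in F\<close>

text \<open>If g moves every vector by an element of F, then g u lies in F exactly when u does, so
  bijectivity of g passes to F.\<close>

lemma ortho_groupI:
  assumes F: "subspace F" and g: "linear g" "bij g" "\<And>u v. B (g u) (g v) = B u v"
    and disp: "\<And>u. g u - u \<in> F" and rad: "\<And>u. u \<in> form_radical B F \<Longrightarrow> g u = u"
  shows "g \<in> ortho_group F B"
proof -
  have "g u \<in> F \<longleftrightarrow> u \<in> F" for u
    using subspace_add[OF F disp, of u u] subspace_diff[OF F, of "g u" "g u - u"] disp by auto
  then have "g ` F = F"
    using surjD[OF bij_is_surj[OF g(2)]] by (fastforce simp: image_iff)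
  then have "bij_betw g F F"
    using bij_is_inj[OF g(2)] by (auto simp: bij_betw_def intro: inj_on_subset)
  then show ?thesis using g rad by (auto simp: ortho_group_def)
qed

lemma root_reflection_eq:
  assumes "bilinear B"
  shows "root_reflection B \<alpha> u = u - (2 * B u \<alpha> / B \<alpha> \<alpha>) *\<^sub>R \<alpha>"
  using bilinear_rmul[OF assms] by (simp add: root_reflection_def coroot_def)

text \<open>All properties go through one induction since the case of inverses uses several of them
  together. A reflection moves vectors along a root, which lies in F and is orthogonal to the
  radical of F.\<close>

lemma weyl_group_isometry:
  fixes B :: "'v::real_vector \<Rightarrow> 'v \<Rightarrow> real"
  assumes B: "bilinear B" and sym: "\<And>u v. B u v = B v u"
    and F: "subspace F" and R: "R \<subseteq> F" and nz: "\<And>\<alpha>. \<alpha> \<in> R \<Longrightarrow> B \<alpha> \<alpha> \<noteq> 0"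
    and "g \<in> weyl_group B R"
  shows "linear g \<and> bij g \<and> (\<forall>u v. B (g u) (g v) = B u v) \<and> (\<forall>u. g u - u \<in> F) \<and>
    (\<forall>u\<in>form_radical B F. g u = u)"
  using \<open>g \<in> weyl_group B R\<close>
proof induction
  case one
  show ?case
    by (intro conjI linear_id bij_id) (simp_all add: subspace_0[OF F])
next
  case (reflection \<alpha>)
  note Bs = bilinear_ladd[OF B] bilinear_lmul[OF B] bilinear_lsub[OF B] bilinear_rsub[OF B]
    bilinear_rmul[OF B] bilinear_radd[OF B]
  have eq: "root_reflection B \<alpha> = (\<lambda>u. u - (2 * B u \<alpha> / B \<alpha> \<alpha>) *\<^sub>R \<alpha>)"
    by (simp add: fun_eq_iff root_reflection_eq[OF B])
  have "linear (root_reflection B \<alpha>)"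
    unfolding eq by (rule linearI) (simp_all add: Bs algebra_simps add_divide_distrib)
  moreover have "bij (root_reflection B \<alpha>)"
    unfolding eq using nz[OF reflection]
    by (intro involuntory_imp_bij) (simp add: Bs algebra_simps)
  moreover have "B (root_reflection B \<alpha> u) (root_reflection B \<alpha> v) = B u v" for u v
    unfolding eq using nz[OF reflection] sym[of \<alpha> v]
    by (simp add: Bs field_simps)
  moreover have "root_reflection B \<alpha> u - u \<in> F" for u
    unfolding eq using reflection R F by (auto simp: subspace_neg subspace_scale)
  moreover have "root_reflection B \<alpha> u = u" if "u \<in> form_radical B F" for u
    unfolding eq using that reflection R by (auto simp: form_radical_def)
  ultimately show ?case by blast
next
  case (mult g h)
  have "g (h u) - u \<in> F" for u
    using subspace_add[OF F, of "g (h u) - h u" "h u - u"] mult.IH by simp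
  moreover have "linear (g \<circ> h)" "bij (g \<circ> h)"
    using mult.IH by (auto simp del: o_apply intro: linear_compose bij_comp)
  ultimately show ?case using mult.IH by (simp add: comp_def)
next
  case (inverse g)
  then have g: "bij g" "linear g" and iso: "\<And>u v. B (g u) (g v) = B u v"
    and disp: "\<And>u. g u - u \<in> F" and rad: "\<And>u. u \<in> form_radical B F \<Longrightarrow> g u = u"
    by blast+
  have gi: "g (inv g u) = u" for u using g by (simp add: bij_is_surj surj_f_inv_f)
  \<comment> \<open>By injectivity of g, each identity may be checked after applying g.\<close>
  have "linear (inv g)"
    by (rule linearI; rule injD[OF bij_is_inj[OF g(1)]])
      (simp_all add: gi linear_add[OF g(2)] linear_scale[OF g(2)])
  moreover have "inv g u - u \<in> F" for u
    using subspace_neg[OF F disp[of "inv g u"]] by (simp add: gi)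
  moreover have "inv g u = u" if "u \<in> form_radical B F" for u
    using rad[OF that] inv_f_f[OF bij_is_inj[OF g(1)], of u] by simp
  moreover have "B (inv g u) (inv g v) = B u v" for u v
    using iso[of "inv g u" "inv g v"] by (simp add: gi)
  ultimately show ?case using bij_imp_bij_inv[OF g(1)] by blast
qed

text \<open>Put D = g - 1. Since g fixes F and preserves B, the values of D are orthogonal to F;
  they also lie in F, so B (D u) (D v) = 0. Invariance of B then makes D skew, and both the linear
  and the quadratic term in t vanish.\<close>

lemma isometry_minus_displacement:
  fixes B :: "'v::real_vector \<Rightarrow> 'v \<Rightarrow> real"
  assumes B: "bilinear B"
    and g: "\<And>u v. B (g u) (g v) = B u v"
    and disp: "\<And>u. g u - u \<in> F" and triv: "\<And>u. u \<in> F \<Longrightarrow> g u = u"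
  shows "B (u - t *\<^sub>R (g u - u)) (v - t *\<^sub>R (g v - v)) = B u v"
proof -
  note Bs = bilinear_ladd[OF B] bilinear_lmul[OF B] bilinear_lsub[OF B] bilinear_rsub[OF B]
    bilinear_rmul[OF B] bilinear_radd[OF B]
  have orth: "B (g x - x) f = 0" if "f \<in> F" for x f
    using g[of x f] triv[OF that] by (simp add: Bs)
  have TT: "B (g u - u) (g v - v) = 0" using orth disp by blast
  have "B (g u) (g v) = B u v + B (g u - u) v + B u (g v - v) + B (g u - u) (g v - v)"
    by (simp add: Bs)
  then have skew: "B (g u - u) v + B u (g v - v) = 0" using g TT by simp
  have "B (u - t *\<^sub>R (g u - u)) (v - t *\<^sub>R (g v - v)) =
      B u v - t * (B (g u - u) v + B u (g v - v)) + t * t * B (g u - u) (g v - v)"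
    unfolding bilinear_lsub[OF B, of u] bilinear_rsub[OF B, of _ v] bilinear_lmul[OF B]
      bilinear_rmul[OF B] by (simp add: algebra_simps)
  then show ?thesis by (simp add: skew TT)
qed

section \<open>Admissibility of the semisimple part of a hyperbolic Coxeter transformation\<close>

theorem proposition6p5:
  fixes l :: nat
    and F R G L :: "'v::euclidean_space set"
    and B :: "'v \<Rightarrow> 'v \<Rightarrow> real"
    and a \<delta> \<Lambda>0 :: 'v
    and \<kappa> :: real and m :: "nat \<Rightarrow> real" and d :: "nat \<Rightarrow> nat"
    and e :: "'v \<Rightarrow>\<^sub>L complex"
    and c c_ss c_unip :: "'v \<Rightarrow> 'v"
    and \<zeta> :: complex
  assumes "l \<ge> 1"
    and "hyperbolic_extension l B a \<delta> \<Lambda>0"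
    and "elliptic_root_system l F B R"
    and "marking F B R G a \<delta>"
    and "reduced_mod G R"
    and "even_scale B R \<kappa>"
    and "exponents l B R G a \<delta> \<kappa> m"
    and "degrees l m d"
    and "euler_vector l F \<Lambda>0 \<kappa> m d e"
    and "\<exists>x. basic_invariants l F B R a \<delta> e d x"
    and "hyperbolic_coxeter l F B R a \<delta> \<kappa> m d c"
    and "jordan_decomposition c c_ss c_unip"
    and "primitive_root_of_unity (d (l+1)) \<zeta>"
    and "\<forall>k. \<forall>f\<in>inv_degree B R a \<delta> e k. \<forall>y\<in>dom_Y a \<delta>. act_fun c_ss f y = \<zeta> ^ k * f y"
    and "regular_complement F B R c_ss L"
  shows "admissible_triplet l F B R a \<delta> e d c_ss \<zeta> L"
proof -
  define N where "N = d (l + 1)"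
  have B: "bilinear B" and sym: "\<And>u v. B u v = B v u"
    using assms(2) by (auto simp: hyperbolic_extension_def)
  have F: "subspace F" and R: "R \<subseteq> F" and nz: "\<And>\<alpha>. \<alpha> \<in> R \<Longrightarrow> B \<alpha> \<alpha> \<noteq> 0"
    using assms(3) by (auto simp: elliptic_root_system_def)
  have N: "N > 0" and cN: "\<And>u. u \<in> F \<Longrightarrow> (c ^^ N) u = u" and "c \<in> weyl_group B R"
    using assms(11) by (auto simp: hyperbolic_coxeter_def is_minimum_def N_def)
  then have c: "linear c" "bij c" "\<And>u v. B (c u) (c v) = B u v" "\<And>u. c u - u \<in> F"
      "\<And>u. u \<in> form_radical B F \<Longrightarrow> c u = u"
    using weyl_group_isometry[OF B sym F R nz] by blast+
  have cpow: "(c ^^ k) u - u \<in> F" for k u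
  proof (induction k)
    case (Suc k)
    then show ?case
      using subspace_add[OF F c(4)[of "(c ^^ k) u"] Suc] by simp
  qed (simp add: subspace_0[OF F])
  have isopow: "B ((c ^^ k) u) ((c ^^ k) v) = B u v" for k u v
    by (induction k) (simp_all add: c(3))
  \<comment> \<open>T^2 = 0: the displacements of c^N lie in F, where c^N is the identity.\<close>
  have "(c ^^ N) ((c ^^ N) x - x) = (c ^^ N) x - x" for x
    by (rule cN[OF cpow])
  note jordan = jordan_semisimple_part[OF assms(12) N this]
  let ?r = "\<lambda>x. x - (1 / real N) *\<^sub>R ((c ^^ N) x - x)"
  have ss: "semisimple_on UNIV c_ss"
    using assms(12) by (simp add: jordan_decomposition_def)
  \<comment> \<open>With r = 1 - T/N the displacement is (c (r u) - r u) - (1/N) T u, a difference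
    of vectors of F.\<close>
  have disp: "c_ss u - u \<in> F" for u
    using subspace_diff[OF F c(4)[of "?r u"] subspace_scale[OF F cpow[of N u], of "1 / real N"]]
    by (simp add: jordan(2))
  have "c_ss \<in> ortho_group F B"
  proof (rule ortho_groupI[OF F])
    show "linear c_ss" using ss by (simp add: semisimple_on_def)
    \<comment> \<open>Finite order gives bijectivity: the inverse is the power with exponent N -
      1.\<close>
    obtain k where "N = Suc k" using N gr0_implies_Suc by blast
    then have "c_ss \<circ> (c_ss ^^ k) = id" "(c_ss ^^ k) \<circ> c_ss = id"
      using jordan(1) by (simp_all add: funpow_Suc_right[symmetric] del: funpow.simps(2))
        (simp add: funpow.simps(2)[symmetric] del: funpow.simps)
    then show "bij c_ss" by (metis o_bij)
    show "B (c_ss u) (c_ss v) = B u v" for u v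
      unfolding jordan(2) c(3)
      by (rule isometry_minus_displacement[OF B isopow cpow cN])
    show "c_ss u - u \<in> F" for u by (rule disp)
    \<comment> \<open>The radical lies in F, so T vanishes on it and r fixes it, as does c.\<close>
    show "c_ss u = u" if "u \<in> form_radical B F" for u
      using that c(5) cN[of u] by (simp add: jordan(2) form_radical_def)
  qed
  \<comment> \<open>No positive power of 0 equals 1.\<close>
  moreover have "\<zeta> \<noteq> 0"
    using assms(13) by (auto simp: primitive_root_of_unity_def is_minimum_def power_0_left)
  moreover obtain x where x: "basic_invariants l F B R a \<delta> e d x"
    using assms(10) by blast
  \<comment> \<open>Any set of basic invariants serves: its member with index \<alpha> is an
    invariant of degree \<open>d \<alpha>\<close>, on which the semisimple part acts by the
    corresponding power of \<zeta>.\<close>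
  moreover have "\<forall>\<alpha>\<in>{1..l+1}. \<forall>y\<in>dom_Y a \<delta>. act_fun c_ss (x \<alpha>) y = \<zeta> ^ d \<alpha> * x \<alpha> y"
    using x assms(14) by (auto simp: basic_invariants_def Let_def)
  ultimately show ?thesis
    using ss disp assms(13,15) unfolding admissible_triplet_def by (intro conjI exI[of _ x]) auto
qed

end
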